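(* For all $b_1>0$, $b_2>0$ and all $t\in\mathbb{R}$, \begin{multline*} \int_{\mathbb{R} \setminus\{0\}}(e^{itx}-1-itx)\Big(e^{b_1 x}\, \frac{b_1(1-e^{x})+e^x}{(1-e^{x})^2}\,1_{(-\infty,0)}(x) + e^{- b_2 x}\, \frac{b_2(1-e^{-x})+e^{-x}}{(1-e^{-x})^2}\,1_{(0,\infty)}(x) \Big)\, dx \\ = it\Big[\big(\Psi^{(0)}(b_1 +it)-\Psi^{(0)}(b_1)\big)- \big(\Psi^{(0)}(b_2 -it)-\Psi^{(0)}(b_2)\big)\Big]. \end{multline*}
   Context: $\Psi^{(0)}(z)=\frac{d}{dz}\log\Gamma(z)=\Gamma'(z)/\Gamma(z)$ is the digamma function and $1_A$ is the indicator function of the set $A$. (The identity is associated with the selfdecomposable generalized z-distribution with characteristic function $\frac{\Gamma(b_1+it)}{\Gamma(b_1)}\frac{\Gamma(b_2-it)}{\Gamma(b_2)}$.) *)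

theory Defs
  imports "HOL-Analysis.Analysis"
begin

(* Levy density of the infinitely divisible law whose characteristic exponent is
   t * (log phi)'(t), centred at its linear term, where
   phi t = Gamma (b1 + it) / Gamma b1 * (Gamma (b2 - it) / Gamma b2).
   With k b y = exp (- b y) / (1 - exp (- y)) it equals - (k b1)' at - x for x < 0
   and - (k b2)' at x for x > 0. *)
definition levy_density :: "real \<Rightarrow> real \<Rightarrow> real \<Rightarrow> real" where
  "levy_density b1 b2 x =
     exp (b1 * x) * ((b1 * (1 - exp x) + exp x) / (1 - exp x)\<^sup>2) * indicator {..<0} x
   + exp (- b2 * x) * ((b2 * (1 - exp (- x)) + exp (- x)) / (1 - exp (- x))\<^sup>2)
       * indicator {0<..} x"

definition levy_integrand :: "real \<Rightarrow> real \<Rightarrow> real \<Rightarrow> real \<Rightarrow> complex" where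
  "levy_integrand b1 b2 t x =
     (exp (\<i> * of_real (t * x)) - 1 - \<i> * of_real (t * x)) * of_real (levy_density b1 b2 x)"

end

theory Submission imports Defs "HOL-Real_Asymp.Real_Asymp"
begin

text \<open>
  With \<open>k b y = exp (- b y) / (1 - exp (- y)) = (\<Sum>n. exp (- (b + n) y))\<close>, the density at
  \<open>x\<close> is \<open>- (k b)' \<bar>x\<bar>\<close> with \<open>b = b1\<close> for \<open>x < 0\<close> and \<open>b = b2\<close> for \<open>x > 0\<close>. On each half line it
  is thus a sum of the exponential densities \<open>a exp (- a \<bar>x\<bar>)\<close> with rates \<open>a = b + n\<close>. The compensated Fourier transform of one exponential
  density is \<open>\<i> t (1 / (a - \<i> t) - 1 / a)\<close> (lemma \<open>has_bochner_integral_exponential_compensated\<close>),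
  and the sum of these over \<open>n\<close> is the partial fraction series of the digamma function
  (lemma \<open>Digamma_diff_sums\<close>).

  Sum and integral may be exchanged because the compensated exponential is \<open>O(x\<^sup>2)\<close>, so the
  \<open>n\<close>-th term has \<open>L\<^sup>1\<close> norm \<open>O(1 / (b + n)\<^sup>2)\<close>. Subtracting only the constant \<open>1\<close> would
  leave norms of order \<open>1 / (b + n)\<close>, which are not summable if \<open>t \<noteq> 0\<close>. The negative half line reduces to
  the positive one by the reflection \<open>(x, t) \<mapsto> (- x, - t)\<close>, which fixes the exponential
  \<open>exp (\<i> t x)\<close> and its compensator.
\<close>

section \<open>The compensated exponential\<close>

abbreviation compensated_iexp :: "real \<Rightarrow> real \<Rightarrow> complex" where
  "compensated_iexp t x \<equiv> exp (\<i> * of_real (t * x)) - 1 - \<i> * of_real (t * x)"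

lemma norm_compensated_iexp_le: "norm (compensated_iexp t x) \<le> (t * x)\<^sup>2"
  using Taylor_exp[of "\<i> * of_real (t * x)" 1]
  by (simp add: norm_mult power_mult_distrib abs_mult power2_eq_square diff_diff_eq)

section \<open>One exponential density\<close>

text \<open>
  This is the integral of the bound \<open>(t x)\<^sup>2 a exp (- a x)\<close> on one compensated term, up to the
  factor \<open>t\<^sup>2\<close>. It gives both the integrability of that term and the summability in \<open>n\<close>.
\<close>
lemma has_bochner_integral_second_moment_exponential:
  fixes a :: real
  assumes a: "a > 0"
  shows "has_bochner_integral lborel (\<lambda>x. indicator {0<..} x * (x\<^sup>2 * (a * exp (- a * x)))) (2 / a\<^sup>2)"
proof -
  define F where "F x = - (x\<^sup>2 + 2 * x / a + 2 / a\<^sup>2) * exp (- a * x)" for x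
  define f where "f x = x\<^sup>2 * (a * exp (- a * x))" for x
  have deriv: "(F has_real_derivative f x) (at x)" for x
    unfolding F_def f_def using a
    by (auto intro!: derivative_eq_intros simp: field_simps power2_eq_square)
  have lim0: "((F \<circ> real_of_ereal) \<longlongrightarrow> - 2 / a\<^sup>2) (at_right 0)"
  proof -
    have "isCont F 0" using deriv DERIV_isCont by blast
    then have "(F \<longlongrightarrow> F 0) (at_right 0)"
      by (simp add: isCont_def filterlim_at_split)
    then show ?thesis
      by (simp add: zero_ereal_def ereal_tendsto_simps F_def)
  qed
  have limI: "((F \<circ> real_of_ereal) \<longlongrightarrow> 0) (at_left \<infinity>)"
    unfolding ereal_tendsto_simps F_def using a by real_asymp
  note FTC = interval_integral_FTC_nonneg[of 0 \<infinity> F f, OF _ deriv _ _ lim0 limI]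
  have cont: "isCont f x" for x unfolding f_def by (intro continuous_intros)
  have nonneg: "f x \<ge> 0" for x using a by (simp add: f_def)
  have "set_integrable lborel (einterval 0 \<infinity>) f" "(LBINT x=0..\<infinity>. f x) = 2 / a\<^sup>2"
    using FTC cont nonneg by auto
  then have "set_integrable lborel {0<..} f" "(LINT x:{0<..}|lborel. f x) = 2 / a\<^sup>2"
    by (simp_all add: zero_ereal_def flip: interval_integral_to_infinity_eq)
  then show ?thesis
    by (simp add: has_bochner_integral_iff set_integrable_def set_lebesgue_integral_def f_def)
qed

text \<open>
  The integrand has the elementary antiderivative \<open>F\<close> below, which vanishes at infinity, so the
  integral is \<open>- F 0\<close>. Since the integrand is complex valued, the fundamental theorem on an
  infinite interval needs integrability beforehand; domination by the second moment provides it.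
\<close>
lemma has_bochner_integral_exponential_compensated:
  fixes a t :: real
  assumes a: "a > 0"
  shows "has_bochner_integral lborel
           (\<lambda>x. indicator {0<..} x *\<^sub>R (compensated_iexp t x * of_real (a * exp (- a * x))))
           (\<i> * of_real t * (inverse (of_real a - \<i> * of_real t) - inverse (of_real a)))"
proof -
  define w where "w = complex_of_real a - \<i> * of_real t"
  have w: "w \<noteq> 0" using a by (auto simp: w_def complex_eq_iff)
  define f where "f x = compensated_iexp t x * of_real (a * exp (- a * x))" for x
  \<comment> \<open>The first summand integrates \<open>exp (\<i> t x) a exp (- a x) = a exp (- w x)\<close>, the second the
    compensator \<open>- (1 + \<i> t x) a exp (- a x)\<close>. Working with an entire function lets the rules for
    field derivatives apply.\<close>
  define G where "G z = - (of_real a / w) * exp (- w * z)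
      + (1 + \<i> * of_real t * (z + inverse (of_real a))) * exp (- of_real a * z)" for z
  define F where "F x = G (complex_of_real x)" for x
  have deriv: "(F has_vector_derivative f x) (at x)" for x
  proof -
    have "(G has_field_derivative (of_real a * exp (- w * of_real x)
        - (of_real a + \<i> * of_real t * of_real a * of_real x) * exp (- of_real a * of_real x))) (at (of_real x))"
      unfolding G_def using a w
      by (auto intro!: derivative_eq_intros simp: field_simps)
    also have "of_real a * exp (- w * of_real x)
        - (of_real a + \<i> * of_real t * of_real a * of_real x) * exp (- of_real a * of_real x) = f x"
    proof -
      have "exp (- w * of_real x) = exp (\<i> * of_real (t * x)) * exp (- of_real a * of_real x)"
        by (simp add: w_def exp_add [symmetric] algebra_simps)
      then show ?thesis
        by (simp add: f_def exp_of_real [symmetric] algebra_simps)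
    qed
    finally show ?thesis
      unfolding F_def by (rule has_vector_derivative_real_field)
  qed
  have cont: "isCont f x" for x unfolding f_def by (intro continuous_intros)
  have meas: "f \<in> borel_measurable borel"
    by (intro borel_measurable_continuous_onI) (simp add: continuous_on_eq_continuous_at cont)
  have int: "set_integrable lborel {0<..} f"
  proof (rule set_integrable_bound)
    show "set_integrable lborel {0<..} (\<lambda>x. t\<^sup>2 * (x\<^sup>2 * (a * exp (- a * x))))"
      using has_bochner_integral_second_moment_exponential[OF a]
      by (intro set_integrable_mult_right) (simp add: set_integrable_def has_bochner_integral_iff)
    show "set_borel_measurable lborel {0<..} f"
      using meas by (simp add: set_borel_measurable_def)
    have "norm (f x) \<le> (t * x)\<^sup>2 * (a * exp (- a * x))" for x
      unfolding f_def norm_mult using a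
      by (intro mult_mono norm_compensated_iexp_le) (auto simp: norm_mult)
    then show "AE x in lborel. x \<in> {0<..} \<longrightarrow> norm (f x) \<le> norm (t\<^sup>2 * (x\<^sup>2 * (a * exp (- a * x))))"
      using a by (simp add: power_mult_distrib abs_mult mult.assoc)
  qed
  have F0: "F 0 = - (\<i> * of_real t * (inverse w - inverse (of_real a)))"
    using w a by (simp add: F_def G_def field_simps) (simp add: w_def algebra_simps)
  have lim0: "((F \<circ> real_of_ereal) \<longlongrightarrow> F 0) (at_right 0)"
  proof -
    have "isCont F 0"
      using deriv has_vector_derivative_continuous by blast
    then have "(F \<longlongrightarrow> F 0) (at_right 0)"
      by (simp add: isCont_def filterlim_at_split)
    then show ?thesis
      by (simp add: zero_ereal_def ereal_tendsto_simps)
  qed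
  have limI: "((F \<circ> real_of_ereal) \<longlongrightarrow> 0) (at_left \<infinity>)"
  proof -
    have "(F \<longlongrightarrow> 0) at_top"
    proof (rule tendsto_norm_zero_cancel, rule tendsto_sandwich[OF _ _ tendsto_const])
      define g where "g x = norm (of_real a / w) * exp (- a * x)
          + (1 + \<bar>t\<bar> * (\<bar>x\<bar> + 1 / a)) * exp (- a * x)" for x
      show "(g \<longlongrightarrow> 0) at_top"
        unfolding g_def using a by real_asymp
      have "norm (F x) \<le> g x" for x
      proof -
        have "norm (1 + \<i> * of_real t * (of_real x + inverse (complex_of_real a))) \<le> 1 + \<bar>t\<bar> * (\<bar>x\<bar> + 1 / a)"
        proof -
          have "norm (1 + \<i> * of_real t * (of_real x + inverse (complex_of_real a)))
            \<le> 1 + norm (\<i> * of_real t * (of_real x + inverse (complex_of_real a)))"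
            by (metis norm_one norm_triangle_ineq)
          also have "\<dots> = 1 + \<bar>t\<bar> * \<bar>x + 1 / a\<bar>"
          proof -
            have "of_real x + inverse (complex_of_real a) = of_real (x + 1 / a)"
              by (simp add: inverse_eq_divide)
            then show ?thesis
              by (simp only: norm_mult norm_of_real) simp
          qed
          also have "\<dots> \<le> 1 + \<bar>t\<bar> * (\<bar>x\<bar> + 1 / a)"
            using a by (intro add_left_mono mult_left_mono) (auto simp: abs_if)
          finally show ?thesis .
        qed
        moreover have "norm (exp (- w * of_real x)) = exp (- a * x)"
          "norm (exp (- complex_of_real a * of_real x)) = exp (- a * x)"
          by (simp_all add: norm_exp_eq_Re w_def)
        ultimately show ?thesis
          unfolding F_def G_def g_def
          by (intro order_trans[OF norm_triangle_ineq] add_mono)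
             (auto simp: norm_mult norm_divide simp del: mult_minus_left intro!: mult_right_mono)
      qed
      then show "\<forall>\<^sub>F x in at_top. norm (F x) \<le> g x" by simp
    qed simp
    then show ?thesis by (simp add: ereal_tendsto_simps)
  qed
  have "(LBINT x=0..\<infinity>. f x) = 0 - F 0"
    using int by (intro interval_integral_FTC_integrable[where F = F] deriv cont lim0 limI)
      (auto simp: zero_ereal_def)
  then show ?thesis
    using int
    by (simp add: has_bochner_integral_iff set_integrable_def set_lebesgue_integral_def
        interval_lebesgue_integral_0_infty f_def F0 w_def)
qed

section \<open>Superposition of the exponential densities\<close>

text \<open>
  Termwise this is \<open>- d/dx\<close> of the geometric series \<open>exp (- b x) / (1 - exp (- x))\<close>; with
  \<open>q = exp (- x)\<close> it reduces to the series of \<open>q ^ n\<close> and of \<open>n q ^ n\<close>.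
\<close>
lemma exponential_densities_sums:
  fixes b x :: real
  assumes x: "x > 0"
  shows "(\<lambda>n. (b + real n) * exp (- (b + real n) * x)) sums
           (exp (- b * x) * ((b * (1 - exp (- x)) + exp (- x)) / (1 - exp (- x))\<^sup>2))"
proof -
  define q where "q = exp (- x)"
  have q: "0 < q" "q < 1" using x by (auto simp: q_def)
  have "(\<lambda>n. b * q ^ n + real (Suc n) * q ^ n - q ^ n) sums
      (b * (1 / (1 - q)) + 1 / (1 - q)\<^sup>2 - 1 / (1 - q))"
    using q by (intro sums_diff sums_add sums_mult geometric_sums geometric_deriv_sums) auto
  also have "b * (1 / (1 - q)) + 1 / (1 - q)\<^sup>2 - 1 / (1 - q) = (b * (1 - q) + q) / (1 - q)\<^sup>2"
    using q by (simp add: field_simps power2_eq_square)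
  finally have "(\<lambda>n. (b + real n) * q ^ n) sums ((b * (1 - q) + q) / (1 - q)\<^sup>2)"
    by (simp add: algebra_simps)
  from sums_mult[OF this, of "exp (- b * x)"]
  have "(\<lambda>n. exp (- b * x) * ((b + real n) * q ^ n)) sums
      (exp (- b * x) * ((b * (1 - q) + q) / (1 - q)\<^sup>2))" .
  moreover have "exp (- b * x) * ((b + real n) * q ^ n) = (b + real n) * exp (- (b + real n) * x)" for n
    by (simp add: q_def exp_of_nat_mult [symmetric] exp_add [symmetric] algebra_simps)
  ultimately show ?thesis
    by (simp only: q_def)
qed

text \<open>
  In a difference of two digamma values, Euler's constant and the convergence-producing terms
  \<open>1 / (n + 1)\<close> of the defining series cancel.
\<close>
lemma Digamma_diff_sums:
  fixes z w :: "'a :: {real_normed_field, banach}"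
  assumes "z \<noteq> 0" "w \<noteq> 0"
  shows "(\<lambda>n. inverse (z + of_nat n) - inverse (w + of_nat n)) sums (Digamma w - Digamma z)"
  using sums_diff[OF summable_sums[OF summable_Digamma[OF assms(2)]]
      summable_sums[OF summable_Digamma[OF assms(1)]]]
  by (simp add: Digamma_def)

section \<open>One half line\<close>

text \<open>
  Dominated convergence for series: the norms are summable pointwise because the exponential
  densities are nonnegative with a finite sum, and their integrals are summable by the second
  moment bound \<open>2 t\<^sup>2 / (b + n)\<^sup>2\<close>.
\<close>
lemma has_bochner_integral_half_line:
  fixes b t :: real
  assumes b: "b > 0"
  shows "has_bochner_integral lborel
           (\<lambda>x. indicator {0<..} x *\<^sub>R (compensated_iexp t x *
              of_real (exp (- b * x) * ((b * (1 - exp (- x)) + exp (- x)) / (1 - exp (- x))\<^sup>2))))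
           (\<i> * of_real t * (Digamma (of_real b) - Digamma (of_real b - \<i> * of_real t)))"
proof -
  define d where "d x = exp (- b * x) * ((b * (1 - exp (- x)) + exp (- x)) / (1 - exp (- x))\<^sup>2)" for x
  define e where "e n x = (b + real n) * exp (- (b + real n) * x)" for n x
  define f where "f n x = indicator {0<..} x *\<^sub>R (compensated_iexp t x * of_real (e n x))" for n x
  define I where "I n = \<i> * of_real t *
      (inverse (of_real b - \<i> * of_real t + of_nat n) - inverse (of_real b + of_nat n))" for n
  have rate_pos: "b + real n > 0" for n using b by (simp add: add_pos_nonneg)
  have e_nonneg: "e n x \<ge> 0" for n x
    using rate_pos[of n] by (simp add: e_def)
  have f: "has_bochner_integral lborel (f n) (I n)" for n
    using has_bochner_integral_exponential_compensated[OF rate_pos[of n], of t]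
    unfolding f_def e_def I_def by (simp add: algebra_simps)
  have d_sums: "(\<lambda>n. e n x) sums d x" if "x > 0" for x
    unfolding e_def d_def using that by (rule exponential_densities_sums)
  have f_sums: "(\<lambda>n. f n x) sums (indicator {0<..} x *\<^sub>R (compensated_iexp t x * of_real (d x)))" for x
  proof (cases "x > 0")
    case True
    then show ?thesis
      using d_sums by (auto simp: f_def sums_of_real_iff intro!: sums_mult)
  qed (simp add: f_def)
  have summable_norm_f: "summable (\<lambda>n. norm (f n x))" for x
  proof (cases "x > 0")
    case True
    then have "summable (\<lambda>n. norm (compensated_iexp t x) * e n x)"
      using d_sums by (intro summable_mult) (auto simp: sums_iff)
    then show ?thesis
      using True e_nonneg by (simp add: f_def norm_mult)
  qed (simp add: f_def)
  have summable_integral_norm: "summable (\<lambda>n. LINT x|lborel. norm (f n x))"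
  proof (rule summable_comparison_test'[where N = 0])
    show "summable (\<lambda>n. t\<^sup>2 * (2 * inverse ((b + real n)\<^sup>2)))"
      using b by (intro summable_mult Polygamma_converges') auto
    fix n :: nat
    define g where "g x = t\<^sup>2 * (indicator {0<..} x * (x\<^sup>2 * e n x))" for x
    have g: "has_bochner_integral lborel g (t\<^sup>2 * (2 / (b + real n)\<^sup>2))"
      unfolding g_def e_def
      by (intro has_bochner_integral_mult_right has_bochner_integral_second_moment_exponential rate_pos)
    have "norm (f n x) \<le> g x" for x
      using mult_right_mono[OF norm_compensated_iexp_le[of t x] e_nonneg[of n x]] e_nonneg[of n x]
      by (auto simp: f_def g_def norm_mult power_mult_distrib mult.assoc split: split_indicator)
    then have "(LINT x|lborel. norm (f n x)) \<le> (LINT x|lborel. g x)"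
      using f g by (intro integral_mono integrable_norm) (auto simp: has_bochner_integral_iff)
    then show "norm (LINT x|lborel. norm (f n x)) \<le> t\<^sup>2 * (2 * inverse ((b + real n)\<^sup>2))"
      using g by (simp add: has_bochner_integral_iff divide_inverse)
  qed
  have f_int: "integrable lborel (f n)" "integral\<^sup>L lborel (f n) = I n" for n
    using f by (auto simp: has_bochner_integral_iff)
  have suminf_f: "(\<Sum>n. f n x) = indicator {0<..} x *\<^sub>R (compensated_iexp t x * of_real (d x))" for x
    using f_sums sums_unique by metis
  have integrable: "integrable lborel (\<lambda>x. indicator {0<..} x *\<^sub>R (compensated_iexp t x * of_real (d x)))"
    using integrable_suminf[of lborel f, OF f_int(1)] summable_norm_f summable_integral_norm
    by (simp add: suminf_f)
  have "I sums (LINT x|lborel. indicator {0<..} x *\<^sub>R (compensated_iexp t x * of_real (d x)))"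
    using sums_integral[of lborel f, OF f_int(1)] summable_norm_f summable_integral_norm
    by (simp add: suminf_f f_int(2))
  moreover have "I sums (\<i> * of_real t * (Digamma (of_real b) - Digamma (of_real b - \<i> * of_real t)))"
    unfolding I_def using b
    by (intro sums_mult Digamma_diff_sums) (auto simp: complex_eq_iff)
  ultimately have "(LINT x|lborel. indicator {0<..} x *\<^sub>R (compensated_iexp t x * of_real (d x)))
      = \<i> * of_real t * (Digamma (of_real b) - Digamma (of_real b - \<i> * of_real t))"
    by (rule sums_unique2)
  with integrable show ?thesis
    by (simp add: has_bochner_integral_iff d_def)
qed

section \<open>Both half lines\<close>

theorem corollary4:
  fixes b1 b2 t :: real
  assumes "b1 > 0" and "b2 > 0"
  shows "set_integrable lborel (UNIV - {0}) (levy_integrand b1 b2 t) \<and>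
         (LINT x:(UNIV - {0})|lborel. levy_integrand b1 b2 t x) =
           \<i> * of_real t *
             ((Digamma (of_real b1 + \<i> * of_real t) - Digamma (of_real b1))
              - (Digamma (of_real b2 - \<i> * of_real t) - Digamma (of_real b2)))"
proof -
  define h where "h b s x = indicator {0<..} x *\<^sub>R (compensated_iexp s x *
      of_real (exp (- b * x) * ((b * (1 - exp (- x)) + exp (- x)) / (1 - exp (- x))\<^sup>2)))" for b s x :: real
  have neg: "has_bochner_integral lborel (\<lambda>x. h b1 (- t) (- x))
      (\<i> * of_real t * (Digamma (of_real b1 + \<i> * of_real t) - Digamma (of_real b1)))"
    using has_bochner_integral_half_line[OF assms(1), of "- t"]
    unfolding h_def [symmetric]
    by (subst (asm) lborel_has_bochner_integral_real_affine_iff[of "- 1" _ _ 0])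
       (simp_all add: algebra_simps)
  have pos: "has_bochner_integral lborel (h b2 t)
      (\<i> * of_real t * (Digamma (of_real b2) - Digamma (of_real b2 - \<i> * of_real t)))"
    unfolding h_def by (rule has_bochner_integral_half_line[OF assms(2)])
  have "(\<lambda>x. h b1 (- t) (- x) + h b2 t x) = (\<lambda>x. indicator (UNIV - {0}) x *\<^sub>R levy_integrand b1 b2 t x)"
  proof
    fix x :: real
    consider "x < 0" | "x = 0" | "x > 0" by linarith
    then show "h b1 (- t) (- x) + h b2 t x = indicator (UNIV - {0}) x *\<^sub>R levy_integrand b1 b2 t x"
      by cases (simp_all add: h_def levy_integrand_def levy_density_def)
  qed
  then show ?thesis
    using has_bochner_integral_add[OF neg pos]
    by (simp add: has_bochner_integral_iff set_integrable_def set_lebesgue_integral_def algebra_simps)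
qed

end
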